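(* (1) Let $(A,\mu)$ be a flexible algebra over $\mathbf{k}$ (i.e., $(xy)x=x(yx)$ for all $x,y\in A$, where $ab=\mu(a,b)$) and $\alpha\colon A\to A$ be an algebra morphism. Then the induced Hom-algebra $A_\alpha=(A,\mu_\alpha=\alpha\circ\mu,\alpha)$ is a Hom-flexible algebra. (2) Let $(A,\mu,\alpha)$ be a Hom-flexible algebra over $\mathbf{k}$. Then the derived Hom-algebra $A^n=(A,\mu^{(n)},\alpha^{2^n})$, where $\mu^{(n)}=\alpha^{2^n-1}\circ\mu$, is also a Hom-flexible algebra for each $n\ge 0$.
   Context: $\mathbf{k}$ is a fixed field of characteristic $0$; all modules, linear maps and tensor products are over $\mathbf{k}$. An algebra $(A,\mu)$ is a $\mathbf{k}$-module with a bilinear multiplication (not necessarily associative or unital); an algebra morphism is a linear map $\alpha$ with $\alpha(\mu(x,y))=\mu(\alpha(x),\alpha(y))$. A Hom-algebra is a triple $(A,\mu,\alpha)$ with $(A,\mu)$ an algebra and $\alpha\colon A\to A$ an algebra morphism of $(A,\mu)$. The Hom-associator is $as_A(x,y,z)=\mu(\mu(x,y),\alpha(z))-\mu(\alpha(x),\mu(y,z))$. A Hom-algebra $A$ is Hom-flexible if $as_A(x,y,x)=0$ for all $x,y\in A$. Powers $\alpha^k$ denote $k$-fold composition, $\alpha^0=\mathrm{Id}$. *)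

theory Defs
  imports Complex_Main
begin

text \<open>
  Modules over a field of characteristic 0 are given, as in \<^theory>\<open>HOL.Vector_Spaces\<close>,
  by a scalar multiplication on an abelian group. The multiplication of an algebra is an
  arbitrary bilinear map: it need be neither associative nor unital.
\<close>

locale nonassoc_algebra = vector_space scale
  for scale :: "'k::field_char_0 \<Rightarrow> 'a::ab_group_add \<Rightarrow> 'a" +
  fixes mu :: "'a \<Rightarrow> 'a \<Rightarrow> 'a"
  assumes linear_left: "Vector_Spaces.linear scale scale (\<lambda>x. mu x y)"
    and linear_right: "Vector_Spaces.linear scale scale (\<lambda>y. mu x y)"

locale flexible_algebra = nonassoc_algebra scale mu
  for scale :: "'k::field_char_0 \<Rightarrow> 'a::ab_group_add \<Rightarrow> 'a" and mu +
  assumes flexible: "mu (mu x y) x = mu x (mu y x)"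

locale nonassoc_algebra_morphism =
  dom: nonassoc_algebra scale1 mu1 + cod: nonassoc_algebra scale2 mu2
  for scale1 :: "'k::field_char_0 \<Rightarrow> 'a::ab_group_add \<Rightarrow> 'a" and mu1
    and scale2 :: "'k \<Rightarrow> 'b::ab_group_add \<Rightarrow> 'b" and mu2 +
  fixes f :: "'a \<Rightarrow> 'b"
  assumes linear_map: "Vector_Spaces.linear scale1 scale2 f"
    and map_mult: "f (mu1 x y) = mu2 (f x) (f y)"

locale hom_algebra = nonassoc_algebra scale mu
  for scale :: "'k::field_char_0 \<Rightarrow> 'a::ab_group_add \<Rightarrow> 'a" and mu +
  fixes alpha :: "'a \<Rightarrow> 'a"
  assumes twist_morphism: "nonassoc_algebra_morphism scale mu scale mu alpha"

definition hom_associator ::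
    "('a \<Rightarrow> 'a \<Rightarrow> 'a) \<Rightarrow> ('a \<Rightarrow> 'a) \<Rightarrow> 'a \<Rightarrow> 'a \<Rightarrow> 'a \<Rightarrow> 'a::ab_group_add" where
  "hom_associator mu alpha x y z = mu (mu x y) (alpha z) - mu (alpha x) (mu y z)"

locale hom_flexible_algebra = hom_algebra scale mu alpha
  for scale :: "'k::field_char_0 \<Rightarrow> 'a::ab_group_add \<Rightarrow> 'a" and mu alpha +
  assumes hom_flexible: "hom_associator mu alpha x y x = 0"

definition induced_mult :: "('a \<Rightarrow> 'a \<Rightarrow> 'a) \<Rightarrow> ('a \<Rightarrow> 'a) \<Rightarrow> 'a \<Rightarrow> 'a \<Rightarrow> 'a" where
  "induced_mult mu alpha x y = alpha (mu x y)"

definition derived_mult :: "('a \<Rightarrow> 'a \<Rightarrow> 'a) \<Rightarrow> ('a \<Rightarrow> 'a) \<Rightarrow> nat \<Rightarrow> 'a \<Rightarrow> 'a \<Rightarrow> 'a" where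
  "derived_mult mu alpha n x y = (alpha ^^ (2 ^ n - 1)) (mu x y)"

definition derived_twist :: "('a \<Rightarrow> 'a) \<Rightarrow> nat \<Rightarrow> 'a \<Rightarrow> 'a" where
  "derived_twist alpha n = alpha ^^ (2 ^ n)"

end

theory Submission
  imports Defs
begin

text \<open>
  Both claims are instances of one twisting principle. Let \<open>(A, \<mu>, \<alpha>)\<close> be a Hom-flexible algebra
  and let \<open>f\<close> be an endomorphism of \<open>(A, \<mu>)\<close> that commutes with \<open>\<alpha>\<close>. In the Hom-associator of
  \<open>(A, f \<circ> \<mu>, f \<circ> \<alpha>)\<close> every term carries \<open>f\<close> once on the outside and once on each argument of the
  outer product; multiplicativity of \<open>f\<close> collects these into \<open>f \<circ> f\<close> applied to the old
  Hom-associator (\<open>hom_associator_twist\<close>). Since \<open>f\<close> is linear, every vanishing of the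
  Hom-associator survives, Hom-flexibility in particular (\<open>hom_flexible_twist\<close>).

  A flexible algebra is a Hom-flexible algebra with twisting map the identity, so twisting it by
  \<open>f = \<alpha>\<close> gives the induced Hom-algebra. Twisting a Hom-flexible algebra by the power
  \<open>f = \<alpha> ^^ (2 ^ n - 1)\<close> gives the derived one, because \<open>f \<circ> \<alpha> = \<alpha> ^^ (2 ^ n)\<close>.
\<close>

lemma morphism_id:
  assumes "nonassoc_algebra scale mu"
  shows "nonassoc_algebra_morphism scale mu scale mu id"
proof -
  interpret nonassoc_algebra scale mu by (fact assms)
  show ?thesis
    by unfold_locales (auto simp: algebra_simps)
qed

lemma morphism_compose:
  assumes "nonassoc_algebra_morphism s1 mu1 s2 mu2 g"
    and "nonassoc_algebra_morphism s2 mu2 s3 mu3 f"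
  shows "nonassoc_algebra_morphism s1 mu1 s3 mu3 (f \<circ> g)"
proof -
  interpret g: nonassoc_algebra_morphism s1 mu1 s2 mu2 g by (fact assms(1))
  interpret f: nonassoc_algebra_morphism s2 mu2 s3 mu3 f by (fact assms(2))
  show ?thesis
    by (intro nonassoc_algebra_morphism.intro nonassoc_algebra_morphism_axioms.intro
          g.dom.nonassoc_algebra_axioms f.cod.nonassoc_algebra_axioms
          Vector_Spaces.linear_compose[OF g.linear_map f.linear_map])
      (simp add: g.map_mult f.map_mult)
qed

lemma morphism_funpow:
  assumes "nonassoc_algebra_morphism scale mu scale mu f"
  shows "nonassoc_algebra_morphism scale mu scale mu (f ^^ n)"
proof (induction n)
  case 0
  have "nonassoc_algebra scale mu"
    using assms by (rule nonassoc_algebra_morphism.axioms)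
  then show ?case
    unfolding funpow.simps(1) by (rule morphism_id)
next
  case (Suc n)
  then show ?case
    unfolding funpow.simps(2) by (rule morphism_compose[OF _ assms])
qed

lemma nonassoc_algebra_induced_mult:
  assumes "nonassoc_algebra_morphism scale mu scale mu f"
  shows "nonassoc_algebra scale (induced_mult mu f)"
proof -
  interpret nonassoc_algebra_morphism scale mu scale mu f by (fact assms)
  have "Vector_Spaces.linear scale scale (\<lambda>x. induced_mult mu f x y)" for y
    using Vector_Spaces.linear_compose[OF dom.linear_left linear_map] by (simp add: o_def induced_mult_def)
  moreover have "Vector_Spaces.linear scale scale (\<lambda>y. induced_mult mu f x y)" for x
    using Vector_Spaces.linear_compose[OF dom.linear_right linear_map] by (simp add: o_def induced_mult_def)
  ultimately show ?thesis
    by (intro nonassoc_algebra.intro nonassoc_algebra_axioms.intro dom.vector_space_axioms)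
qed

text \<open>
  Both \<open>g \<circ> (f \<circ> \<mu>)\<close> and \<open>(f \<circ> \<mu>) \<circ> (g \<times> g)\<close> equal \<open>f \<circ> g \<circ> \<mu>\<close>, the former only because \<open>f\<close> and
  \<open>g\<close> commute.
\<close>

lemma morphism_induced_mult:
  assumes f: "nonassoc_algebra_morphism scale mu scale mu f"
    and g: "nonassoc_algebra_morphism scale mu scale mu g"
    and comm: "f \<circ> g = g \<circ> f"
  shows "nonassoc_algebra_morphism scale (induced_mult mu f) scale (induced_mult mu f) g"
proof -
  interpret g: nonassoc_algebra_morphism scale mu scale mu g by (fact g)
  have "g (f x) = f (g x)" for x
    using comm by (metis comp_apply)
  then have "g (induced_mult mu f x y) = induced_mult mu f (g x) (g y)" for x y
    by (simp add: induced_mult_def g.map_mult)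
  then show ?thesis
    by (intro nonassoc_algebra_morphism.intro nonassoc_algebra_morphism_axioms.intro
          nonassoc_algebra_induced_mult[OF f] g.linear_map)
qed

text \<open>
  By multiplicativity one \<open>f\<close> is pulled out of the two arguments of each outer product, where it
  joins the \<open>f\<close> of the twisted multiplication; by additivity \<open>f \<circ> f\<close> then comes out of the difference.
\<close>

lemma hom_associator_twist:
  assumes "nonassoc_algebra_morphism scale mu scale mu f"
  shows "hom_associator (induced_mult mu f) (f \<circ> alpha) x y z = f (f (hom_associator mu alpha x y z))"
proof -
  interpret f: nonassoc_algebra_morphism scale mu scale mu f by (fact assms)
  interpret lin: Vector_Spaces.linear scale scale f by (fact f.linear_map)
  show ?thesis
    by (simp add: hom_associator_def induced_mult_def f.map_mult lin.diff)
qed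

lemma hom_flexible_twist:
  assumes A: "hom_flexible_algebra scale mu alpha"
    and f: "nonassoc_algebra_morphism scale mu scale mu f"
    and comm: "f \<circ> alpha = alpha \<circ> f"
  shows "hom_flexible_algebra scale (induced_mult mu f) (f \<circ> alpha)"
proof -
  interpret A: hom_flexible_algebra scale mu alpha by (fact A)
  interpret lin: Vector_Spaces.linear scale scale f
    using f by (rule nonassoc_algebra_morphism.linear_map)
  have "nonassoc_algebra_morphism scale mu scale mu (f \<circ> alpha)"
    by (rule morphism_compose[OF A.twist_morphism f])
  moreover have "f \<circ> (f \<circ> alpha) = f \<circ> alpha \<circ> f"
    by (metis comm comp_assoc)
  ultimately have twist:
      "nonassoc_algebra_morphism scale (induced_mult mu f) scale (induced_mult mu f) (f \<circ> alpha)"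
    by (rule morphism_induced_mult[OF f])
  have "hom_associator (induced_mult mu f) (f \<circ> alpha) x y x = 0" for x y
    by (simp add: hom_associator_twist[OF f] A.hom_flexible lin.zero)
  with twist show ?thesis
    by (intro hom_flexible_algebra.intro hom_flexible_algebra_axioms.intro hom_algebra.intro
          hom_algebra_axioms.intro nonassoc_algebra_induced_mult[OF f])
qed

lemma flexible_imp_hom_flexible_id:
  assumes "flexible_algebra scale mu"
  shows "hom_flexible_algebra scale mu id"
proof -
  interpret flexible_algebra scale mu by (fact assms)
  have "hom_associator mu id x y x = 0" for x y
    by (simp add: hom_associator_def flexible)
  then show ?thesis
    by (intro hom_flexible_algebra.intro hom_flexible_algebra_axioms.intro hom_algebra.intro
          hom_algebra_axioms.intro nonassoc_algebra_axioms morphism_id)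
qed

theorem theorem4p4:
  fixes scale :: "'k::field_char_0 \<Rightarrow> 'a::ab_group_add \<Rightarrow> 'a"
  shows "(\<forall>mu alpha.
            flexible_algebra scale mu \<longrightarrow>
            nonassoc_algebra_morphism scale mu scale mu alpha \<longrightarrow>
            hom_flexible_algebra scale (induced_mult mu alpha) alpha)
       \<and> (\<forall>mu alpha.
            hom_flexible_algebra scale mu alpha \<longrightarrow>
            (\<forall>n::nat. hom_flexible_algebra scale (derived_mult mu alpha n) (derived_twist alpha n)))"
proof (intro conjI allI impI)
  fix mu :: "'a \<Rightarrow> 'a \<Rightarrow> 'a" and alpha
  assume "flexible_algebra scale mu" and "nonassoc_algebra_morphism scale mu scale mu alpha"
  then show "hom_flexible_algebra scale (induced_mult mu alpha) alpha"
    using hom_flexible_twist[OF flexible_imp_hom_flexible_id, of scale mu alpha] by simp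
next
  fix mu :: "'a \<Rightarrow> 'a \<Rightarrow> 'a" and alpha and n :: nat
  assume A: "hom_flexible_algebra scale mu alpha"
  then interpret hom_flexible_algebra scale mu alpha .
  define f where "f = alpha ^^ (2 ^ n - 1)"
  have "f \<circ> alpha = alpha ^^ Suc (2 ^ n - 1)"
    unfolding f_def by (simp only: funpow_Suc_right)
  then have "f \<circ> alpha = derived_twist alpha n"
    by (simp add: derived_twist_def)
  moreover have "induced_mult mu f = derived_mult mu alpha n"
    by (intro ext) (simp add: f_def induced_mult_def derived_mult_def)
  moreover have "f \<circ> alpha = alpha \<circ> f"
    unfolding f_def by (metis funpow.simps(2) funpow_Suc_right)
  moreover have "nonassoc_algebra_morphism scale mu scale mu f"
    unfolding f_def by (rule morphism_funpow[OF twist_morphism])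
  ultimately show "hom_flexible_algebra scale (derived_mult mu alpha n) (derived_twist alpha n)"
    using hom_flexible_twist[OF A] by metis
qed

end
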